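(* Fix $T\ge1$. Suppose the SELM assumption stated in the context holds. Then for any $t\in\{0,1,\dots,T-1\}$ and $k=\sqrt T$, there exist constants $c_0,\ell_0>0$ such that the dual function $q^{(t,k)}$ satisfies the weak error bound condition with parameters $c_0,\ell_0$ on $\mathbb R_+^L\times\mathbb R^M$; that is, for any $(\lambda^*,\eta^* )\in\mathcal V^*_{t,k}$ and any $(\lambda,\eta)\in\mathbb R_+^L\times\mathbb R^M$ with $\mathrm{dist}((\lambda,\eta),\mathcal V_{t,k}^* )\ge\ell_0$, $$q^{(t,k)}(\lambda^*,\eta^* )-q^{(t,k)}(\lambda,\eta)\ge c_0\cdot\mathrm{dist}((\lambda,\eta),\mathcal V_{t,k}^* ).$$
   Context: Notation: $\mathrm{dist}(\mathbf x,K)=\min_{\mathbf y\in K}\|\mathbf x-\mathbf y\|_2$. $\Delta\subseteq\mathbb R^d$ is a compact convex set. $\{\xi^t\}_{t\ge0}$ is an arbitrarily time-varying process, $\{\gamma^t\}_{t\ge0}$ are i.i.d. copies of a random variable $\gamma$, and for each $j\in\{1,\dots,M\}$ $\{h_j^t\}_{t\ge0}$ is an i.i.d. sequence of random vectors in $\mathbb R^d$. The functions $f(\mu,\xi)$ and $g_i(\mu,\gamma)$, $i\in\{1,\dots,L\}$, are deterministic real-valued functions convex in $\mu$. $\mathcal F_t$ denotes the history $\{\xi^\tau,\gamma^\tau,h_j^\tau\}_{\tau\le t-1}$, and for all $t$ the variables $\xi^t,\gamma^t,h_1^t,\dots,h_M^t$ are jointly independent and independent of $\mathcal F_t$. Put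 $f^t(\mu)=f(\mu,\xi^t)$, $g_i^t(\mu)=g_i(\mu,\gamma^t)$, $\overline f^t(\mu)=\mathbb E[f^t(\mu)\mid\mathcal F_t]$, $\overline g_i(\mu)=\mathbb E[g_i^t(\mu)]$, $\overline{\mathbf g}=[\overline g_1,\dots,\overline g_L]^{\mathsf T}$, $\overline h_j(\mu)=\langle\mathbb E[h_j^t],\mu\rangle$, $\overline{\mathbf h}=[\overline h_1,\dots,\overline h_M]^{\mathsf T}$; $\mathbf b=[b_1,\dots,b_M]^{\mathsf T}$ is a constant vector. Standing boundedness: for a norm $\|\cdot\|$ on $\mathbb R^d$ with dual norm $\|\cdot\|_*$ there are constants $D_1,D_2,F,G,H>0$ such that for all $\mu\in\Delta$ and all $t$ the subgradients in $\mu$ satisfy $\|\nabla f^t(\mu)\|_*\le D_1$, $\sum_i\|\nabla g_i^t(\mu)\|_*^2\le D_2^2$, and $|f^t(\mu)|\le F$, $\sum_i|g_i^t(\mu)|^2\le G^2$, $\sum_j\|h_j^t\|_*^2\le H^2$. For a time slot $t$ and integer $k\ge1$ let $\overline f^{t,k}=\frac1k\sum_{i=0}^{k-1}\overline f^{t+i}$. Consider the program $(P_{t,k})$: $\min_{\mu\in\Delta}\overline f^{t,k}(\mu)$ s.t. $\overline{\mathbf g}(\mu)\le0$, $\overline{\mathbf h}(\mu)=\mathbf b$, with dual function, for $\lambda\in\mathbb R_+^L$, $\eta\in\mathbb R^M$, $$q^{(t,k)}(\lambda,\eta)=\min_{\mu\in\Delta}\ \overline f^{t,k}(\mu)+\sum_{i=1}^L\lambda_i\overline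 g_i(\mu)+\sum_{j=1}^M\eta_j(\overline h_j(\mu)-b_j).$$ SELM assumption (sequential existence of Lagrange multipliers). For any $t$ and any $k$, the set of optimal solutions of $(P_{t,k})$ is nonempty and $\mathcal V_{t,k}^*:=\mathrm{argmax}_{\lambda\in\mathbb R_+^L,\eta\in\mathbb R^M}q^{(t,k)}(\lambda,\eta)$ is nonempty and bounded. Furthermore there is an absolute constant $B>0$ such that for every $t\in\{0,\dots,T-1\}$ and $k=\sqrt T$, $\max_{[\lambda,\eta]\in\mathcal V^*_{t,k}}\|[\lambda,\eta]\|_2\le B$. (Here $\sqrt T$ is taken to be an integer.) *)

theory Defs
  imports "HOL-Probability.Probability"
begin

definition is_norm :: "('a::real_vector \<Rightarrow> real) \<Rightarrow> bool" where
  "is_norm N \<longleftrightarrow>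
     (\<forall>x. 0 \<le> N x) \<and> (\<forall>x. N x = 0 \<longleftrightarrow> x = 0) \<and>
     (\<forall>c x. N (c *\<^sub>R x) = \<bar>c\<bar> * N x) \<and> (\<forall>x y. N (x + y) \<le> N x + N y)"

definition dual_norm :: "('a::real_inner \<Rightarrow> real) \<Rightarrow> 'a \<Rightarrow> real" where
  "dual_norm N y = (SUP x\<in>{x. N x \<le> 1}. y \<bullet> x)"

text \<open>Subgradients are taken relative to \<open>S\<close>, since the convex functions
  need only be convex on the feasible set.\<close>

definition is_subgradient :: "'a::real_inner set \<Rightarrow> ('a \<Rightarrow> real) \<Rightarrow> 'a \<Rightarrow> 'a \<Rightarrow> bool" where
  "is_subgradient S \<phi> x v \<longleftrightarrow> (\<forall>y\<in>S. \<phi> x + v \<bullet> (y - x) \<le> \<phi> y)"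


definition feasible ::
  "'a set \<Rightarrow> ('a \<Rightarrow> real ^ 'l) \<Rightarrow> ('a \<Rightarrow> real ^ 'm) \<Rightarrow> real ^ 'm \<Rightarrow> 'a \<Rightarrow> bool" where
  "feasible \<Delta> gb hb b \<mu> \<longleftrightarrow> \<mu> \<in> \<Delta> \<and> (\<forall>i. gb \<mu> $ i \<le> 0) \<and> hb \<mu> = b"

definition optimal_solutions ::
  "'a set \<Rightarrow> ('a \<Rightarrow> real) \<Rightarrow> ('a \<Rightarrow> real ^ 'l) \<Rightarrow> ('a \<Rightarrow> real ^ 'm) \<Rightarrow> real ^ 'm \<Rightarrow> 'a set" where
  "optimal_solutions \<Delta> fb gb hb b = {\<mu>. is_arg_min fb (feasible \<Delta> gb hb b) \<mu>}"

definition lagrangian ::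
  "('a \<Rightarrow> real) \<Rightarrow> ('a \<Rightarrow> real ^ 'l) \<Rightarrow> ('a \<Rightarrow> real ^ 'm) \<Rightarrow> real ^ 'm
    \<Rightarrow> (real ^ 'l) \<times> (real ^ 'm) \<Rightarrow> 'a \<Rightarrow> real" where
  "lagrangian fb gb hb b = (\<lambda>(l, \<eta>) \<mu>.
     fb \<mu> + (\<Sum>i\<in>UNIV. l $ i * gb \<mu> $ i) + (\<Sum>j\<in>UNIV. \<eta> $ j * (hb \<mu> $ j - b $ j)))"

text \<open>The infimum is a minimum under the standing assumptions, see
  \<open>dual_function_attained\<close> below.\<close>

definition dual_function ::
  "'a set \<Rightarrow> ('a \<Rightarrow> real) \<Rightarrow> ('a \<Rightarrow> real ^ 'l) \<Rightarrow> ('a \<Rightarrow> real ^ 'm) \<Rightarrow> real ^ 'm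
    \<Rightarrow> (real ^ 'l) \<times> (real ^ 'm) \<Rightarrow> real" where
  "dual_function \<Delta> fb gb hb b v = (INF \<mu>\<in>\<Delta>. lagrangian fb gb hb b v \<mu>)"

definition dual_domain :: "((real ^ 'l) \<times> (real ^ 'm)) set" where
  "dual_domain = {v. \<forall>i. 0 \<le> fst v $ i}"

definition maximizers :: "('v \<Rightarrow> real) \<Rightarrow> 'v set \<Rightarrow> 'v set" where
  "maximizers q D = {v. is_arg_max q (\<lambda>v. v \<in> D) v}"

definition weak_error_bound ::
  "('v::metric_space \<Rightarrow> real) \<Rightarrow> 'v set \<Rightarrow> real \<Rightarrow> real \<Rightarrow> bool" where
  "weak_error_bound q D c\<^sub>0 l\<^sub>0 \<longleftrightarrow>
     (\<forall>w \<in> maximizers q D. \<forall>v\<in>D. l\<^sub>0 \<le> infdist v (maximizers q D) \<longrightarrow>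
        c\<^sub>0 * infdist v (maximizers q D) \<le> q w - q v)"

definition window_average :: "(nat \<Rightarrow> 'a \<Rightarrow> real) \<Rightarrow> nat \<Rightarrow> nat \<Rightarrow> 'a \<Rightarrow> real" where
  "window_average fb t k \<mu> = (1 / real k) * (\<Sum>i<k. fb (t + i) \<mu>)"

text \<open>On pairs, the library's \<open>norm\<close> is the Euclidean norm of the
  concatenated vector.\<close>

definition SELM ::
  "'a set \<Rightarrow> (nat \<Rightarrow> 'a \<Rightarrow> real) \<Rightarrow> ('a \<Rightarrow> real ^ 'l) \<Rightarrow> ('a \<Rightarrow> real ^ 'm)
    \<Rightarrow> real ^ 'm \<Rightarrow> nat \<Rightarrow> bool" where
  "SELM \<Delta> fb gb hb b T \<longleftrightarrow>
     (\<forall>t k. 1 \<le> k \<longrightarrow>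
        optimal_solutions \<Delta> (window_average fb t k) gb hb b \<noteq> {} \<and>
        maximizers (dual_function \<Delta> (window_average fb t k) gb hb b) dual_domain \<noteq> {} \<and>
        bounded (maximizers (dual_function \<Delta> (window_average fb t k) gb hb b) dual_domain)) \<and>
     (\<exists>B>0. \<forall>t<T. \<forall>k. real k = sqrt (real T) \<longrightarrow>
        (\<forall>v \<in> maximizers (dual_function \<Delta> (window_average fb t k) gb hb b) dual_domain.
           norm v \<le> B))"


datatype 'm source = Objective | Inequality | Equality 'm

definition source_algebra ::
  "'w measure \<Rightarrow> 'x measure \<Rightarrow> 'c measure \<Rightarrow> (nat \<Rightarrow> 'w \<Rightarrow> 'x) \<Rightarrow> (nat \<Rightarrow> 'w \<Rightarrow> 'c)
    \<Rightarrow> ('m \<Rightarrow> nat \<Rightarrow> 'w \<Rightarrow> real ^ 'd) \<Rightarrow> nat \<Rightarrow> 'm source \<Rightarrow> 'w measure" where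
  "source_algebra M X C \<xi> \<gamma> h t s =
     (case s of
        Objective \<Rightarrow> vimage_algebra (space M) (\<xi> t) X
      | Inequality \<Rightarrow> vimage_algebra (space M) (\<gamma> t) C
      | Equality j \<Rightarrow> vimage_algebra (space M) (h j t) borel)"

definition slot_algebra ::
  "'w measure \<Rightarrow> 'x measure \<Rightarrow> 'c measure \<Rightarrow> (nat \<Rightarrow> 'w \<Rightarrow> 'x) \<Rightarrow> (nat \<Rightarrow> 'w \<Rightarrow> 'c)
    \<Rightarrow> ('m \<Rightarrow> nat \<Rightarrow> 'w \<Rightarrow> real ^ 'd) \<Rightarrow> nat \<Rightarrow> 'w measure" where
  "slot_algebra M X C \<xi> \<gamma> h t =
     sigma (space M) (\<Union>s. sets (source_algebra M X C \<xi> \<gamma> h t s))"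

definition history ::
  "'w measure \<Rightarrow> 'x measure \<Rightarrow> 'c measure \<Rightarrow> (nat \<Rightarrow> 'w \<Rightarrow> 'x) \<Rightarrow> (nat \<Rightarrow> 'w \<Rightarrow> 'c)
    \<Rightarrow> ('m \<Rightarrow> nat \<Rightarrow> 'w \<Rightarrow> real ^ 'd) \<Rightarrow> nat \<Rightarrow> 'w measure" where
  "history M X C \<xi> \<gamma> h t =
     sigma (space M) (\<Union>\<tau><t. \<Union>s. sets (source_algebra M X C \<xi> \<gamma> h \<tau> s))"

text \<open>A conditional expectation is determined only almost surely. Since
  \<open>\<xi> t\<close> is independent of the history, the one below is almost surely constant
  (lemma \<open>fbar_version\<close>), and \<open>fbar\<close> denotes that constant.\<close>

definition fbar ::
  "'w measure \<Rightarrow> 'x measure \<Rightarrow> 'c measure \<Rightarrow> (nat \<Rightarrow> 'w \<Rightarrow> 'x) \<Rightarrow> (nat \<Rightarrow> 'w \<Rightarrow> 'c)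
    \<Rightarrow> ('m \<Rightarrow> nat \<Rightarrow> 'w \<Rightarrow> real ^ 'd) \<Rightarrow> (real ^ 'd \<Rightarrow> 'x \<Rightarrow> real)
    \<Rightarrow> nat \<Rightarrow> real ^ 'd \<Rightarrow> real" where
  "fbar M X C \<xi> \<gamma> h f t \<mu> =
     (THE c. AE \<omega> in M.
        real_cond_exp M (history M X C \<xi> \<gamma> h t) (\<lambda>\<omega>. f \<mu> (\<xi> t \<omega>)) \<omega> = c)"

text \<open>The expectations below do not depend on the slot (lemmas \<open>gbar_eq\<close> and
  \<open>hbar_eq\<close>), so they are taken at slot 0.\<close>

definition gbar ::
  "'w measure \<Rightarrow> (nat \<Rightarrow> 'w \<Rightarrow> 'c) \<Rightarrow> ('l \<Rightarrow> real ^ 'd \<Rightarrow> 'c \<Rightarrow> real) \<Rightarrow> real ^ 'd \<Rightarrow> real ^ 'l" where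
  "gbar M \<gamma> g \<mu> = (\<chi> i. integral\<^sup>L M (\<lambda>\<omega>. g i \<mu> (\<gamma> 0 \<omega>)))"

definition hbar ::
  "'w measure \<Rightarrow> ('m \<Rightarrow> nat \<Rightarrow> 'w \<Rightarrow> real ^ 'd) \<Rightarrow> real ^ 'd \<Rightarrow> real ^ 'm" where
  "hbar M h \<mu> = (\<chi> j. integral\<^sup>L M (h j 0) \<bullet> \<mu>)"

text \<open>\<open>df\<close> and \<open>dg\<close> are the subgradient selections written as nabla in
  the boundedness assumptions; these are only required almost surely.\<close>

locale online_stochastic_program = prob_space M
  for M :: "'w measure" +
  fixes X :: "'x measure" and C :: "'c measure"
    and \<Delta> :: "(real ^ 'd) set"
    and \<xi> :: "nat \<Rightarrow> 'w \<Rightarrow> 'x"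
    and \<gamma> :: "nat \<Rightarrow> 'w \<Rightarrow> 'c"
    and h :: "'m::finite \<Rightarrow> nat \<Rightarrow> 'w \<Rightarrow> real ^ 'd"
    and f :: "real ^ 'd \<Rightarrow> 'x \<Rightarrow> real"
    and g :: "'l::finite \<Rightarrow> real ^ 'd \<Rightarrow> 'c \<Rightarrow> real"
    and df :: "real ^ 'd \<Rightarrow> 'x \<Rightarrow> real ^ 'd"
    and dg :: "'l \<Rightarrow> real ^ 'd \<Rightarrow> 'c \<Rightarrow> real ^ 'd"
    and N :: "real ^ 'd \<Rightarrow> real"
    and D\<^sub>1 D\<^sub>2 F G H :: real
  assumes compact_feasible: "compact \<Delta>" and convex_feasible: "convex \<Delta>"
    and measurable_\<xi>: "\<And>t. \<xi> t \<in> M \<rightarrow>\<^sub>M X"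
    and iid_\<gamma>: "indep_vars (\<lambda>_. C) \<gamma> UNIV" "\<And>t. distr M C (\<gamma> t) = distr M C (\<gamma> 0)"
    and iid_h: "\<And>j. indep_vars (\<lambda>_. borel) (h j) UNIV"
      "\<And>j t. distr M borel (h j t) = distr M borel (h j 0)"
    and slot_indep:
      "\<And>t. indep_sets (\<lambda>s. sets (source_algebra M X C \<xi> \<gamma> h t s)) UNIV"
    and slot_indep_history:
      "\<And>t. indep_set (sets (slot_algebra M X C \<xi> \<gamma> h t)) (sets (history M X C \<xi> \<gamma> h t))"
    and measurable_f: "\<And>\<mu>. \<mu> \<in> \<Delta> \<Longrightarrow> f \<mu> \<in> borel_measurable X"
    and measurable_g: "\<And>i \<mu>. \<mu> \<in> \<Delta> \<Longrightarrow> g i \<mu> \<in> borel_measurable C"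
    and convex_f: "\<And>x. x \<in> space X \<Longrightarrow> convex_on \<Delta> (\<lambda>\<mu>. f \<mu> x)"
    and convex_g: "\<And>i c. c \<in> space C \<Longrightarrow> convex_on \<Delta> (\<lambda>\<mu>. g i \<mu> c)"
    and norm_N: "is_norm N"
    and bounds_pos: "0 < D\<^sub>1" "0 < D\<^sub>2" "0 < F" "0 < G" "0 < H"
    and subgradient_f:
      "\<And>t. AE \<omega> in M. \<forall>\<mu>\<in>\<Delta>. is_subgradient \<Delta> (\<lambda>\<nu>. f \<nu> (\<xi> t \<omega>)) \<mu> (df \<mu> (\<xi> t \<omega>))"
    and subgradient_g:
      "\<And>t i. AE \<omega> in M. \<forall>\<mu>\<in>\<Delta>. is_subgradient \<Delta> (\<lambda>\<nu>. g i \<nu> (\<gamma> t \<omega>)) \<mu> (dg i \<mu> (\<gamma> t \<omega>))"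
    and subgradient_f_bound:
      "\<And>t. AE \<omega> in M. \<forall>\<mu>\<in>\<Delta>. dual_norm N (df \<mu> (\<xi> t \<omega>)) \<le> D\<^sub>1"
    and subgradient_g_bound:
      "\<And>t. AE \<omega> in M. \<forall>\<mu>\<in>\<Delta>. (\<Sum>i\<in>UNIV. (dual_norm N (dg i \<mu> (\<gamma> t \<omega>)))\<^sup>2) \<le> D\<^sub>2\<^sup>2"
    and f_bound: "\<And>t. AE \<omega> in M. \<forall>\<mu>\<in>\<Delta>. \<bar>f \<mu> (\<xi> t \<omega>)\<bar> \<le> F"
    and g_bound: "\<And>t. AE \<omega> in M. \<forall>\<mu>\<in>\<Delta>. (\<Sum>i\<in>UNIV. \<bar>g i \<mu> (\<gamma> t \<omega>)\<bar>\<^sup>2) \<le> G\<^sup>2"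
    and h_bound: "\<And>t. AE \<omega> in M. (\<Sum>j\<in>UNIV. (dual_norm N (h j t \<omega>))\<^sup>2) \<le> H\<^sup>2"


lemma is_norm_le_norm:
  fixes N :: "'a::euclidean_space \<Rightarrow> real"
  assumes "is_norm N"
  shows "\<exists>K>0. \<forall>x. N x \<le> K * norm x"
proof (intro exI conjI allI)
  have N: "\<And>x. 0 \<le> N x" "\<And>x. N x = 0 \<longleftrightarrow> x = 0" "\<And>c x. N (c *\<^sub>R x) = \<bar>c\<bar> * N x"
    "\<And>x y. N (x + y) \<le> N x + N y"
    using assms by (auto simp: is_norm_def)
  let ?K = "(\<Sum>b\<in>Basis. N b) + 1 :: real"
  show "0 < ?K" using sum_nonneg[of Basis N] N(1) by (simp add: add_nonneg_pos)
  fix x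
  have "N (\<Sum>b\<in>A. (x \<bullet> b) *\<^sub>R b) \<le> (\<Sum>b\<in>A. \<bar>x \<bullet> b\<bar> * N b)" if "finite A" for A
    using that
  proof (induction A)
    case empty
    have "N 0 = 0" using N(2)[of 0] by simp
    then show ?case by simp
  next
    case (insert a A)
    have "N (\<Sum>b\<in>insert a A. (x \<bullet> b) *\<^sub>R b) \<le> N ((x \<bullet> a) *\<^sub>R a) + N (\<Sum>b\<in>A. (x \<bullet> b) *\<^sub>R b)"
      using insert N(4) by simp
    with insert show ?case by (simp add: N(3))
  qed
  from this[of Basis] have "N x \<le> (\<Sum>b\<in>Basis. \<bar>x \<bullet> b\<bar> * N b)"
    by (simp add: euclidean_representation)
  also have "\<dots> \<le> (\<Sum>b\<in>Basis. norm x * N b)"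
    by (intro sum_mono mult_right_mono Basis_le_norm N(1))
  also have "\<dots> \<le> ?K * norm x"
    unfolding sum_distrib_left[symmetric] distrib_right by (simp add: mult.commute)
  finally show "N x \<le> ?K * norm x" .
qed

lemma norm_le_is_norm:
  fixes N :: "'a::euclidean_space \<Rightarrow> real"
  assumes "is_norm N"
  shows "\<exists>K>0. \<forall>x. norm x \<le> K * N x"
proof -
  have N: "\<And>x. 0 \<le> N x" "\<And>x. N x = 0 \<longleftrightarrow> x = 0" "\<And>c x. N (c *\<^sub>R x) = \<bar>c\<bar> * N x"
    "\<And>x y. N (x + y) \<le> N x + N y"
    using assms by (auto simp: is_norm_def)
  obtain K where K: "0 < K" "\<And>x. N x \<le> K * norm x" using is_norm_le_norm[OF assms] by blast
  have diff: "\<bar>N x - N y\<bar> \<le> K * norm (x - y)" for x y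
  proof -
    have "N x \<le> N (x - y) + N y" using N(4)[of "x - y" y] by simp
    moreover have "N y \<le> N (y - x) + N x" using N(4)[of "y - x" x] by simp
    ultimately show ?thesis using K(2)[of "x - y"] K(2)[of "y - x"] by (auto simp: norm_minus_commute)
  qed
  have "K-lipschitz_on UNIV N"
    using diff K(1) by (intro lipschitz_onI) (auto simp: dist_norm)
  then have cont: "continuous_on (sphere 0 1) N"
    using lipschitz_on_continuous_on continuous_on_subset by blast
  have "sphere (0::'a) 1 \<noteq> {}" by simp
  then obtain x0 where x0: "x0 \<in> sphere 0 1" "\<And>y. y \<in> sphere 0 1 \<Longrightarrow> N x0 \<le> N y"
    using continuous_attains_inf[OF compact_sphere _ cont] by blast
  have pos: "0 < N x0" using x0(1) N(1)[of x0] N(2)[of x0] by (auto simp: order.strict_iff_order)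
  have "norm x \<le> (1 / N x0) * N x" for x
  proof (cases "x = 0")
    case False
    have "N x0 \<le> N ((1 / norm x) *\<^sub>R x)" using False by (intro x0(2)) simp
    then show ?thesis using False pos by (simp add: N(3) field_simps)
  qed (use N in simp)
  with pos show ?thesis by (intro exI[of _ "1 / N x0"]) simp
qed

lemma dual_norm_bdd:
  fixes N :: "'a::euclidean_space \<Rightarrow> real"
  assumes "is_norm N"
  shows "bdd_above ((\<lambda>x. y \<bullet> x) ` {x. N x \<le> 1})"
proof -
  obtain K where K: "0 < K" "\<And>x. norm x \<le> K * N x" using norm_le_is_norm[OF assms] by blast
  show ?thesis
  proof (rule bdd_aboveI2)
    fix x assume "x \<in> {x. N x \<le> 1}"
    then have "K * N x \<le> K * 1" using K(1) by (intro mult_left_mono) auto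
    with K(2)[of x] have "norm x \<le> K" by simp
    have "y \<bullet> x \<le> norm y * norm x" by (rule norm_cauchy_schwarz)
    also have "\<dots> \<le> norm y * K" using \<open>norm x \<le> K\<close> by (intro mult_left_mono) auto
    finally show "y \<bullet> x \<le> norm y * K" .
  qed
qed

lemma inner_le_dual_norm:
  fixes N :: "'a::euclidean_space \<Rightarrow> real"
  assumes "is_norm N"
  shows "y \<bullet> x \<le> dual_norm N y * N x"
proof (cases "x = 0")
  case True
  moreover have "N 0 = 0" using assms unfolding is_norm_def by blast
  ultimately show ?thesis by simp
next
  case False
  then have pos: "0 < N x" using assms by (auto simp: is_norm_def order.strict_iff_order)
  have "y \<bullet> ((1 / N x) *\<^sub>R x) \<le> dual_norm N y"
    unfolding dual_norm_def
    using pos assms by (intro cSUP_upper dual_norm_bdd) (auto simp: is_norm_def)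
  then show ?thesis using pos by (simp add: field_simps)
qed

lemma abs_le_of_sum_squares:
  fixes a :: "'i::finite \<Rightarrow> real"
  assumes "(\<Sum>i\<in>UNIV. (a i)\<^sup>2) \<le> R\<^sup>2" "0 \<le> R"
  shows "\<bar>a i\<bar> \<le> R"
proof -
  have "(a i)\<^sup>2 \<le> (\<Sum>i\<in>UNIV. (a i)\<^sup>2)" by (intro member_le_sum) auto
  with assms show ?thesis by (metis abs_le_square_iff abs_of_nonneg order.trans)
qed

lemma subgradient_lipschitz:
  fixes N :: "'a::euclidean_space \<Rightarrow> real"
  assumes N: "is_norm N" and K: "\<And>x. N x \<le> K * norm x" and R: "0 \<le> R"
    and sub: "\<forall>\<mu>\<in>S. is_subgradient S \<phi> \<mu> (d \<mu>)"
    and bd: "\<forall>\<mu>\<in>S. dual_norm N (d \<mu>) \<le> R" and xy: "x \<in> S" "y \<in> S"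
  shows "\<bar>\<phi> x - \<phi> y\<bar> \<le> R * K * norm (x - y)"
proof -
  have *: "\<phi> x - \<phi> y \<le> R * K * norm (x - y)" if "x \<in> S" "y \<in> S" for x y
  proof -
    have "\<phi> x - \<phi> y \<le> d x \<bullet> (x - y)"
      using sub that by (fastforce simp: is_subgradient_def inner_diff_right)
    also have "\<dots> \<le> dual_norm N (d x) * N (x - y)" by (rule inner_le_dual_norm[OF N])
    also have "\<dots> \<le> R * (K * norm (x - y))"
      using bd that R K N by (intro mult_mono) (auto simp: is_norm_def)
    finally show ?thesis by (simp add: mult.assoc)
  qed
  from *[OF xy] *[OF xy(2,1)] show ?thesis by (simp add: norm_minus_commute abs_le_iff)
qed

context online_stochastic_program
begin

lemma measurable_\<gamma>: "\<gamma> t \<in> M \<rightarrow>\<^sub>M C"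
  using iid_\<gamma>(1) by (simp add: indep_vars_def)

lemma measurable_h: "h j t \<in> M \<rightarrow>\<^sub>M borel"
  using iid_h(1)[of j] by (simp add: indep_vars_def)

lemma measurable_f_\<xi>: "\<mu> \<in> \<Delta> \<Longrightarrow> (\<lambda>\<omega>. f \<mu> (\<xi> t \<omega>)) \<in> borel_measurable M"
  by (rule measurable_compose[OF measurable_\<xi> measurable_f])

lemma measurable_g_\<gamma>: "\<mu> \<in> \<Delta> \<Longrightarrow> (\<lambda>\<omega>. g i \<mu> (\<gamma> t \<omega>)) \<in> borel_measurable M"
  by (rule measurable_compose[OF measurable_\<gamma> measurable_g])

lemma integrable_f: "\<mu> \<in> \<Delta> \<Longrightarrow> integrable M (\<lambda>\<omega>. f \<mu> (\<xi> t \<omega>))"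
  using f_bound[of t] by (intro integrable_const_bound[of _ F] measurable_f_\<xi>) auto

lemma integrable_g:
  assumes "\<mu> \<in> \<Delta>"
  shows "integrable M (\<lambda>\<omega>. g i \<mu> (\<gamma> t \<omega>))"
proof (intro integrable_const_bound[of _ G] measurable_g_\<gamma> assms)
  show "AE \<omega> in M. norm (g i \<mu> (\<gamma> t \<omega>)) \<le> G"
    using g_bound[of t]
  proof eventually_elim
    case (elim \<omega>)
    then have "(\<Sum>i\<in>UNIV. (g i \<mu> (\<gamma> t \<omega>))\<^sup>2) \<le> G\<^sup>2" using assms by simp
    then show ?case using abs_le_of_sum_squares[of "\<lambda>i. g i \<mu> (\<gamma> t \<omega>)" G i] bounds_pos by simp
  qed
qed

lemma source_subset_events: "sets (source_algebra M X C \<xi> \<gamma> h t s) \<subseteq> events"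
  using slot_indep[of t] by (auto simp: indep_sets_def)

lemma subalgebra_history: "subalgebra M (history M X C \<xi> \<gamma> h t)"
proof -
  have "(\<Union>\<tau><t. \<Union>s. sets (source_algebra M X C \<xi> \<gamma> h \<tau> s)) \<subseteq> events"
    using source_subset_events by blast
  moreover from this have "(\<Union>\<tau><t. \<Union>s. sets (source_algebra M X C \<xi> \<gamma> h \<tau> s)) \<subseteq> Pow (space M)"
    using sets.space_closed by blast
  ultimately show ?thesis
    unfolding subalgebra_def history_def by (simp add: space_measure_of sets.sigma_sets_subset)
qed

lemma \<xi>_measurable_slot: "\<xi> t \<in> slot_algebra M X C \<xi> \<gamma> h t \<rightarrow>\<^sub>M X"
proof -
  have sub: "(\<Union>s. sets (source_algebra M X C \<xi> \<gamma> h t s)) \<subseteq> Pow (space M)"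
    using source_subset_events sets.space_closed by blast
  have "\<xi> t \<in> vimage_algebra (space M) (\<xi> t) X \<rightarrow>\<^sub>M X"
    using measurable_\<xi>[of t] by (intro measurable_vimage_algebra1) (auto simp: measurable_def)
  moreover have "sets (vimage_algebra (space M) (\<xi> t) X) \<subseteq> sets (slot_algebra M X C \<xi> \<gamma> h t)"
  proof
    fix A assume "A \<in> sets (vimage_algebra (space M) (\<xi> t) X)"
    then have "A \<in> sets (source_algebra M X C \<xi> \<gamma> h t Objective)" by (simp add: source_algebra_def)
    then show "A \<in> sets (slot_algebra M X C \<xi> \<gamma> h t)"
      unfolding slot_algebra_def using sub by (auto intro!: in_sets_SUP)
  qed
  ultimately show ?thesis
    unfolding measurable_def by (auto simp: slot_algebra_def space_measure_of_conv)
qed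

lemma fbar_version:
  assumes \<mu>: "\<mu> \<in> \<Delta>"
  shows "AE \<omega> in M. real_cond_exp M (history M X C \<xi> \<gamma> h t) (\<lambda>\<omega>. f \<mu> (\<xi> t \<omega>)) \<omega>
           = fbar M X C \<xi> \<gamma> h f t \<mu>"
    and "fbar M X C \<xi> \<gamma> h f t \<mu> = expectation (\<lambda>\<omega>. f \<mu> (\<xi> t \<omega>))"
proof -
  let ?F = "history M X C \<xi> \<gamma> h t" and ?S = "slot_algebra M X C \<xi> \<gamma> h t"
  let ?Y = "\<lambda>\<omega>. f \<mu> (\<xi> t \<omega>)" and ?c = "expectation (\<lambda>\<omega>. f \<mu> (\<xi> t \<omega>))"
  interpret sub: finite_measure_subalgebra M ?F
    using subalgebra_history by unfold_locales
  have int: "integrable M ?Y" by (rule integrable_f[OF \<mu>])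
  have YS: "?Y \<in> borel_measurable ?S"
    by (rule measurable_compose[OF \<xi>_measurable_slot measurable_f[OF \<mu>]])
  have AE: "AE \<omega> in M. real_cond_exp M ?F ?Y \<omega> = ?c"
  proof (rule sub.real_cond_exp_charact)
    fix A assume A: "A \<in> sets ?F"
    then have AM: "A \<in> events" using subalgebra_history[of t] by (auto simp: subalgebra_def)
    have "indep_var borel (indicator A) borel ?Y"
      unfolding indep_var_eq
    proof (intro conjI)
      show "random_variable borel (indicator A :: 'w \<Rightarrow> real)" using AM by simp
      show "random_variable borel ?Y" by (rule measurable_f_\<xi>[OF \<mu>])
      have gen1: "{(indicator A :: 'w \<Rightarrow> real) -` B \<inter> space M |B. B \<in> sets borel} \<subseteq> sets ?F"
      proof -
        have "(indicator A :: 'w \<Rightarrow> real) \<in> borel_measurable ?F" using A by simp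
        then show ?thesis using subalgebra_history[of t]
          by (auto simp: subalgebra_def dest!: measurable_sets)
      qed
      have gen2: "{?Y -` B \<inter> space M |B. B \<in> sets borel} \<subseteq> sets ?S"
      proof -
        have "space ?S = space M" by (simp add: slot_algebra_def space_measure_of_conv)
        then show ?thesis using measurable_sets[OF YS] by auto
      qed
      have s1: "sigma_sets (space M) {(indicator A :: 'w \<Rightarrow> real) -` B \<inter> space M |B. B \<in> sets borel}
          \<subseteq> sets ?F"
        using sets.sigma_sets_subset[OF gen1] subalgebra_history[of t] by (simp add: subalgebra_def)
      have s2: "sigma_sets (space M) {?Y -` B \<inter> space M |B. B \<in> sets borel} \<subseteq> sets ?S"
        using sets.sigma_sets_subset[OF gen2] by (simp add: slot_algebra_def space_measure_of_conv)
      show "indep_set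
         (sigma_sets (space M) {(indicator A :: 'w \<Rightarrow> real) -` B \<inter> space M |B. B \<in> sets borel})
         (sigma_sets (space M) {?Y -` B \<inter> space M |B. B \<in> sets borel})"
        unfolding indep_sets2_eq
      proof (intro conjI ballI)
        note ind = slot_indep_history[of t, unfolded indep_sets2_eq]
        show "sigma_sets (space M) {(indicator A :: 'w \<Rightarrow> real) -` B \<inter> space M |B. B \<in> sets borel} \<subseteq> events"
          using s1 ind by (meson order.trans)
        show "sigma_sets (space M) {?Y -` B \<inter> space M |B. B \<in> sets borel} \<subseteq> events"
          using s2 ind by (meson order.trans)
        fix a b
        assume "a \<in> sigma_sets (space M) {(indicator A :: 'w \<Rightarrow> real) -` B \<inter> space M |B. B \<in> sets borel}"
          and "b \<in> sigma_sets (space M) {?Y -` B \<inter> space M |B. B \<in> sets borel}"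
        with s1 s2 have "a \<in> sets ?F" "b \<in> sets ?S" by blast+
        with ind have "prob (b \<inter> a) = prob b * prob a" by blast
        then show "prob (a \<inter> b) = prob a * prob b" by (simp only: Int_commute mult.commute)
      qed
    qed
    from indep_var_lebesgue_integral[OF this _ int] AM
    have "(\<integral>\<omega>\<in>A. ?Y \<omega> \<partial>M) = prob A * ?c"
      by (simp add: set_lebesgue_integral_def less_top[symmetric])
    then show "(\<integral>\<omega>\<in>A. ?Y \<omega> \<partial>M) = (\<integral>\<omega>\<in>A. ?c \<partial>M)"
      using AM by (simp add: set_lebesgue_integral_def)
  qed (use int in auto)
  have "fbar M X C \<xi> \<gamma> h f t \<mu> = ?c"
    unfolding fbar_def
  proof (rule the_equality)
    show "AE \<omega> in M. real_cond_exp M ?F ?Y \<omega> = ?c" by (rule AE)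
  next
    fix c assume "AE \<omega> in M. real_cond_exp M ?F ?Y \<omega> = c"
    with AE have "AE \<omega> in M. c = ?c" by eventually_elim simp
    then show "c = ?c" by simp
  qed
  with AE show "AE \<omega> in M. real_cond_exp M ?F ?Y \<omega> = fbar M X C \<xi> \<gamma> h f t \<mu>"
    and "fbar M X C \<xi> \<gamma> h f t \<mu> = ?c" by simp_all
qed

lemma gbar_eq:
  assumes "\<mu> \<in> \<Delta>"
  shows "gbar M \<gamma> g \<mu> $ i = expectation (\<lambda>\<omega>. g i \<mu> (\<gamma> t \<omega>))"
  using integral_distr[OF measurable_\<gamma> measurable_g[OF assms], of t i]
    integral_distr[OF measurable_\<gamma> measurable_g[OF assms], of 0 i] iid_\<gamma>(2)[of t]
  by (simp add: gbar_def)

lemma hbar_eq: "hbar M h \<mu> $ j = expectation (h j t) \<bullet> \<mu>"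
  using integral_distr[OF measurable_h, of "\<lambda>x. x" j t]
    integral_distr[OF measurable_h, of "\<lambda>x. x" j 0] iid_h(2)[of j t]
  by (simp add: hbar_def)

lemma lipschitz_expectation:
  assumes "\<And>\<mu>. \<mu> \<in> \<Delta> \<Longrightarrow> integrable M (\<phi> \<mu>)" "0 \<le> R"
    and "AE \<omega> in M. \<forall>x\<in>\<Delta>. \<forall>y\<in>\<Delta>. \<bar>\<phi> x \<omega> - \<phi> y \<omega>\<bar> \<le> R * norm (x - y)"
  shows "continuous_on \<Delta> (\<lambda>\<mu>. expectation (\<phi> \<mu>))"
proof (rule lipschitz_on_continuous_on[of R], rule lipschitz_onI)
  fix x y assume xy: "x \<in> \<Delta>" "y \<in> \<Delta>"
  have "dist (expectation (\<phi> x)) (expectation (\<phi> y)) = \<bar>expectation (\<lambda>\<omega>. \<phi> x \<omega> - \<phi> y \<omega>)\<bar>"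
    using assms(1) xy by (simp add: dist_real_def)
  also have "\<dots> \<le> expectation (\<lambda>\<omega>. \<bar>\<phi> x \<omega> - \<phi> y \<omega>\<bar>)" by (rule integral_abs_bound)
  also have "\<dots> \<le> expectation (\<lambda>\<omega>. R * norm (x - y))"
    using assms(1,3) xy by (intro integral_mono_AE) auto
  also have "\<dots> = R * dist x y" by (simp add: prob_space dist_norm)
  finally show "dist (expectation (\<phi> x)) (expectation (\<phi> y)) \<le> R * dist x y" .
qed (use assms in simp)

lemma continuous_fbar: "continuous_on \<Delta> (fbar M X C \<xi> \<gamma> h f t)"
proof -
  obtain K where K: "0 < K" "\<And>x. N x \<le> K * norm x" using is_norm_le_norm[OF norm_N] by blast
  have "AE \<omega> in M. \<forall>x\<in>\<Delta>. \<forall>y\<in>\<Delta>. \<bar>f x (\<xi> t \<omega>) - f y (\<xi> t \<omega>)\<bar> \<le> D\<^sub>1 * K * norm (x - y)"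
    using subgradient_f[of t] subgradient_f_bound[of t]
  proof eventually_elim
    case (elim \<omega>)
    then show ?case using bounds_pos
      by (intro ballI subgradient_lipschitz[OF norm_N K(2), where d = "\<lambda>\<mu>. df \<mu> (\<xi> t \<omega>)"
            and \<phi> = "\<lambda>\<mu>. f \<mu> (\<xi> t \<omega>)" and S = \<Delta>]) auto
  qed
  from lipschitz_expectation[OF integrable_f _ this] K bounds_pos
  show ?thesis by (simp add: fbar_version(2) cong: continuous_on_cong)
qed

lemma continuous_gbar: "continuous_on \<Delta> (\<lambda>\<mu>. gbar M \<gamma> g \<mu> $ i)"
proof -
  obtain K where K: "0 < K" "\<And>x. N x \<le> K * norm x" using is_norm_le_norm[OF norm_N] by blast
  have "AE \<omega> in M. \<forall>x\<in>\<Delta>. \<forall>y\<in>\<Delta>. \<bar>g i x (\<gamma> 0 \<omega>) - g i y (\<gamma> 0 \<omega>)\<bar> \<le> D\<^sub>2 * K * norm (x - y)"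
    using subgradient_g[of i 0] subgradient_g_bound[of 0]
  proof eventually_elim
    case (elim \<omega>)
    have "\<forall>\<mu>\<in>\<Delta>. dual_norm N (dg i \<mu> (\<gamma> 0 \<omega>)) \<le> D\<^sub>2"
    proof
      fix \<mu> assume "\<mu> \<in> \<Delta>"
      then have "\<bar>dual_norm N (dg i \<mu> (\<gamma> 0 \<omega>))\<bar> \<le> D\<^sub>2"
        using elim(2) bounds_pos
        by (intro abs_le_of_sum_squares[of "\<lambda>i. dual_norm N (dg i \<mu> (\<gamma> 0 \<omega>))"]) auto
      then show "dual_norm N (dg i \<mu> (\<gamma> 0 \<omega>)) \<le> D\<^sub>2" by simp
    qed
    then show ?case using bounds_pos elim
      by (intro ballI subgradient_lipschitz[OF norm_N K(2), where d = "\<lambda>\<mu>. dg i \<mu> (\<gamma> 0 \<omega>)"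
            and \<phi> = "\<lambda>\<mu>. g i \<mu> (\<gamma> 0 \<omega>)" and S = \<Delta>]) auto
  qed
  from lipschitz_expectation[OF integrable_g _ this] K bounds_pos
  show ?thesis by (simp add: gbar_def)
qed

lemma dual_function_attained:
  assumes "\<Delta> \<noteq> {}"
  shows "\<exists>\<mu>\<in>\<Delta>. is_arg_min
           (lagrangian (window_average (fbar M X C \<xi> \<gamma> h f) t k) (gbar M \<gamma> g) (hbar M h) b v)
           (\<lambda>\<mu>. \<mu> \<in> \<Delta>) \<mu> \<and>
         dual_function \<Delta> (window_average (fbar M X C \<xi> \<gamma> h f) t k) (gbar M \<gamma> g) (hbar M h) b v
           = lagrangian (window_average (fbar M X C \<xi> \<gamma> h f) t k) (gbar M \<gamma> g) (hbar M h) b v \<mu>"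
proof -
  let ?L = "lagrangian (window_average (fbar M X C \<xi> \<gamma> h f) t k) (gbar M \<gamma> g) (hbar M h) b v"
  have "continuous_on \<Delta> ?L"
    unfolding lagrangian_def window_average_def case_prod_beta hbar_def vec_lambda_beta
    by (intro continuous_on_add continuous_on_mult continuous_on_sum continuous_on_diff
        continuous_on_const continuous_on_inner continuous_on_id continuous_fbar continuous_gbar)
  from continuous_attains_inf[OF compact_feasible assms this]
  obtain \<mu> where \<mu>: "\<mu> \<in> \<Delta>" "\<forall>\<nu>\<in>\<Delta>. ?L \<mu> \<le> ?L \<nu>" by blast
  then have "(INF \<nu>\<in>\<Delta>. ?L \<nu>) = ?L \<mu>"
    by (intro cInf_eq_minimum) auto
  with \<mu> show ?thesis
    unfolding dual_function_def by (intro bexI[of _ \<mu>]) (auto simp: is_arg_min_linorder)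
qed

end

end

theory Submission
  imports Defs
begin

text \<open>
  The dual function is a pointwise minimum of functions affine in the multipliers, so it is concave;
  being finite on the whole of a Euclidean space, it is also continuous. Everything else is a fact
  about a continuous concave function \<open>q\<close> on a closed convex set \<open>D\<close> whose set \<open>V\<close> of maximizers is
  nonempty and bounded.

  For such a function the points of \<open>D\<close> at distance exactly \<open>l\<close> from \<open>V\<close> form a compact set that
  misses \<open>V\<close>, so on it \<open>q\<close> stays below its maximum by some \<open>\<delta> > 0\<close>. Given a point of \<open>D\<close>
  farther away, the segment to its projection on \<open>V\<close> crosses this set, and by concavity the gap grows
  at least linearly along the segment. So the gap is at least \<open>\<delta> / l\<close> times the distance
  (\<open>concave_weak_error_bound\<close>). Any positive \<open>l\<close> will do; only \<open>c\<^sub>0\<close> depends on the function.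
\<close>

lemma maximizers_iff:
  fixes q :: "'v \<Rightarrow> real"
  shows "w \<in> maximizers q D \<longleftrightarrow> w \<in> D \<and> (\<forall>v\<in>D. q v \<le> q w)"
  unfolding maximizers_def by (auto simp: is_arg_max_linorder)

lemma closed_maximizers:
  fixes q :: "'v::metric_space \<Rightarrow> real"
  assumes "closed D" "continuous_on D q"
  shows "closed (maximizers q D)"
proof (cases "maximizers q D = {}")
  case False
  then obtain w where w: "w \<in> maximizers q D" by blast
  then have "maximizers q D = D \<inter> q -` {q w..}"
    by (fastforce simp: maximizers_iff)
  then show ?thesis
    using continuous_closed_preimage[OF assms(2,1) closed_atLeast] by simp
qed simp

text \<open>The projection of \<open>v\<close> on \<open>V\<close> is also a nearest point of \<open>V\<close> for everything on the segment
  between the two, so distances to \<open>V\<close> scale linearly along that segment.\<close>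

lemma infdist_segment_to_nearest:
  fixes v w :: "'v::real_normed_vector"
  assumes w: "w \<in> V" and near: "infdist v V = dist v w" and s: "0 \<le> s" "s \<le> 1"
  shows "infdist ((1 - s) *\<^sub>R w + s *\<^sub>R v) V = s * dist v w"
proof (rule antisym)
  let ?p = "(1 - s) *\<^sub>R w + s *\<^sub>R v"
  have "?p - w = s *\<^sub>R (v - w)" "v - ?p = (1 - s) *\<^sub>R (v - w)"
    by (simp_all add: algebra_simps)
  then have pw: "dist ?p w = s * dist v w" and vp: "dist v ?p = (1 - s) * dist v w"
    using s by (simp_all add: dist_norm)
  show "infdist ?p V \<le> s * dist v w"
    using infdist_le[OF w, of ?p] pw by simp
  have "dist v w \<le> infdist ?p V + dist v ?p"
    using infdist_triangle[of v V ?p] near by simp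
  then show "s * dist v w \<le> infdist ?p V"
    unfolding vp left_diff_distrib by simp
qed

text \<open>Boundedness of the set of maximizers makes the distance level set compact, which is what
  turns the pointwise gap there into a uniform one.\<close>

lemma uniform_gap_at_distance:
  fixes q :: "'v::euclidean_space \<Rightarrow> real"
  assumes D: "closed D" and cont: "continuous_on D q"
    and bnd: "bounded (maximizers q D)" and l: "0 < l" and w: "w \<in> maximizers q D"
  shows "\<exists>\<delta>>0. \<forall>p\<in>D. infdist p (maximizers q D) = l \<longrightarrow> \<delta> \<le> q w - q p"
proof -
  let ?V = "maximizers q D"
  define S where "S = {p \<in> D. infdist p ?V = l}"
  have ne: "?V \<noteq> {}" using w by blast
  show ?thesis
  proof (cases "S = {}")
    case True
    \<comment> \<open>Every point of \<open>D\<close> may lie within distance less than \<open>l\<close>; then any constant works.\<close>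
    then show ?thesis unfolding S_def by (intro exI[of _ 1]) auto
  next
    case False
    have "compact ?V"
      using bnd closed_maximizers[OF D cont] by (simp add: compact_eq_bounded_closed)
    then have "compact {p. infdist p ?V \<le> l}"
      by (rule compact_infdist_le[OF ne _ l])
    moreover have "closed S"
      unfolding S_def Collect_conj_eq
      using D by (intro closed_Int closed_Collect_eq continuous_intros) simp_all
    moreover have "S \<subseteq> {p. infdist p ?V \<le> l}" unfolding S_def by auto
    ultimately have "compact S" using closed_subset compact_Int_closed by (metis inf.absorb2)
    moreover have "continuous_on S q"
      using cont by (rule continuous_on_subset) (auto simp: S_def)
    ultimately obtain p0 where p0: "p0 \<in> S" "\<And>p. p \<in> S \<Longrightarrow> q p \<le> q p0"
      using continuous_attains_sup[OF _ False] by blast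
    have "p0 \<notin> ?V" using p0(1) l by (auto simp: S_def)
    then have "q p0 < q w"
      using p0(1) w by (force simp: S_def maximizers_iff)
    with p0(2) show ?thesis
      by (intro exI[of _ "q w - q p0"]) (auto simp: S_def)
  qed
qed

theorem concave_weak_error_bound:
  fixes q :: "'v::euclidean_space \<Rightarrow> real"
  assumes D: "closed D" and conc: "concave_on D q" and cont: "continuous_on D q"
    and ne: "maximizers q D \<noteq> {}" and bnd: "bounded (maximizers q D)" and l: "0 < l"
  shows "\<exists>c>0. weak_error_bound q D c l"
proof -
  let ?V = "maximizers q D"
  obtain w0 where w0: "w0 \<in> ?V" using ne by blast
  obtain \<delta> where \<delta>: "0 < \<delta>" "\<And>p. p \<in> D \<Longrightarrow> infdist p ?V = l \<Longrightarrow> \<delta> \<le> q w0 - q p"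
    using uniform_gap_at_distance[OF D cont bnd l w0] by blast
  have "\<delta> / l * infdist v ?V \<le> q w - q v"
    if w: "w \<in> ?V" and v: "v \<in> D" and far: "l \<le> infdist v ?V" for w v
  proof -
    obtain w' where w': "w' \<in> ?V" and near: "infdist v ?V = dist v w'"
      using infdist_attains_inf[OF closed_maximizers[OF D cont] ne] by blast
    have same: "q w = q w0" "q w' = q w0"
      using w w' w0 by (auto simp: maximizers_iff intro: antisym)
    define d where "d = dist v w'"
    define s where "s = l / d"
    have d: "0 < d" "l \<le> d" using far l near by (auto simp: d_def)
    have s: "0 < s" "s \<le> 1" using d l by (auto simp: s_def)
    let ?p = "(1 - s) *\<^sub>R w' + s *\<^sub>R v"
    have w'D: "w' \<in> D" using w' by (simp add: maximizers_iff)
    have conv: "convex D" using conc by (simp add: concave_on_iff)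
    have pD: "?p \<in> D"
      using convexD[OF conv w'D v, of "1 - s" s] s by simp
    have "infdist ?p ?V = l"
      using infdist_segment_to_nearest[OF w' near, of s] s d by (simp add: s_def d_def)
    with \<delta>(2) pD have "\<delta> \<le> q w0 - q ?p" by blast
    moreover have "(1 - s) * q w' + s * q v \<le> q ?p"
      using conc w'D v s by (simp add: concave_on_iff)
    ultimately have "\<delta> \<le> s * (q w0 - q v)"
      using same by (simp add: algebra_simps)
    then show ?thesis
      using d l same near by (simp add: s_def d_def[symmetric] field_simps)
  qed
  with \<delta>(1) l show ?thesis
    unfolding weak_error_bound_def by (intro exI[of _ "\<delta> / l"]) auto
qed

lemma lagrangian_affine:
  assumes "u + u' = 1"
  shows "lagrangian fb gb hb b (u *\<^sub>R x + u' *\<^sub>R y) \<mu>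
    = u * lagrangian fb gb hb b x \<mu> + u' * lagrangian fb gb hb b y \<mu>"
proof -
  have "u * fb \<mu> + u' * fb \<mu> = fb \<mu>"
    using assms by (simp flip: distrib_right)
  then show ?thesis
    unfolding lagrangian_def case_prod_beta
    by (simp add: distrib_left distrib_right sum.distrib sum_distrib_left mult.assoc)
qed

lemma closed_dual_domain: "closed (dual_domain :: ((real ^ 'l::finite) \<times> (real ^ 'm::finite)) set)"
  unfolding dual_domain_def
  by (intro closed_Collect_all closed_Collect_le continuous_intros)

lemma convex_dual_domain: "convex (dual_domain :: ((real ^ 'l::finite) \<times> (real ^ 'm::finite)) set)"
  unfolding dual_domain_def convex_def by auto

context online_stochastic_program
begin

text \<open>At a convex combination of multipliers, the minimizer of the Lagrangian is merely a candidate
  for the two end points, where it gives upper bounds for the dual function.\<close>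

lemma concave_dual_function:
  assumes "\<Delta> \<noteq> {}"
  shows "concave_on UNIV
    (dual_function \<Delta> (window_average (fbar M X C \<xi> \<gamma> h f) t k) (gbar M \<gamma> g) (hbar M h) b)"
    (is "concave_on _ ?q")
  unfolding concave_on_iff
proof (intro conjI ballI allI impI)
  let ?L = "lagrangian (window_average (fbar M X C \<xi> \<gamma> h f) t k) (gbar M \<gamma> g) (hbar M h) b"
  have le: "?q v \<le> ?L v \<mu>" if "\<mu> \<in> \<Delta>" for v \<mu>
  proof -
    obtain \<nu> where "is_arg_min (?L v) (\<lambda>\<mu>. \<mu> \<in> \<Delta>) \<nu>" "?q v = ?L v \<nu>"
      using dual_function_attained[OF assms] by blast
    with that show ?thesis by (simp add: is_arg_min_linorder)
  qed
  fix x y :: "(real ^ 'l) \<times> (real ^ 'm)" and u u' :: real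
  assume u: "0 \<le> u" "0 \<le> u'" "u + u' = 1"
  obtain \<mu> where \<mu>: "\<mu> \<in> \<Delta>" "?q (u *\<^sub>R x + u' *\<^sub>R y) = ?L (u *\<^sub>R x + u' *\<^sub>R y) \<mu>"
    using dual_function_attained[OF assms] by blast
  have "u * ?q x + u' * ?q y \<le> u * ?L x \<mu> + u' * ?L y \<mu>"
    using u le[OF \<mu>(1)] by (intro add_mono mult_left_mono)
  also have "\<dots> = ?q (u *\<^sub>R x + u' *\<^sub>R y)"
    using \<mu>(2) lagrangian_affine[OF u(3)] by metis
  finally show "u * ?q x + u' * ?q y \<le> ?q (u *\<^sub>R x + u' *\<^sub>R y)" .
qed simp

end

theorem lemma5:
  fixes M :: "'w measure" and X :: "'x measure" and C :: "'c measure"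
    and \<Delta> :: "(real ^ 'd) set"
    and \<xi> :: "nat \<Rightarrow> 'w \<Rightarrow> 'x" and \<gamma> :: "nat \<Rightarrow> 'w \<Rightarrow> 'c"
    and h :: "'m::finite \<Rightarrow> nat \<Rightarrow> 'w \<Rightarrow> real ^ 'd"
    and f :: "real ^ 'd \<Rightarrow> 'x \<Rightarrow> real"
    and g :: "'l::finite \<Rightarrow> real ^ 'd \<Rightarrow> 'c \<Rightarrow> real"
    and df :: "real ^ 'd \<Rightarrow> 'x \<Rightarrow> real ^ 'd"
    and dg :: "'l \<Rightarrow> real ^ 'd \<Rightarrow> 'c \<Rightarrow> real ^ 'd"
    and N :: "real ^ 'd \<Rightarrow> real"
    and D\<^sub>1 D\<^sub>2 F G H :: real
    and b :: "real ^ 'm"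
    and T t k :: nat
  assumes "online_stochastic_program M X C \<Delta> \<xi> \<gamma> h f g df dg N D\<^sub>1 D\<^sub>2 F G H"
    and "1 \<le> T"
    and "SELM \<Delta> (fbar M X C \<xi> \<gamma> h f) (gbar M \<gamma> g) (hbar M h) b T"
    and "t < T"
    and "real k = sqrt (real T)"
  shows "\<exists>c\<^sub>0>0. \<exists>l\<^sub>0>0. weak_error_bound
           (dual_function \<Delta> (window_average (fbar M X C \<xi> \<gamma> h f) t k) (gbar M \<gamma> g) (hbar M h) b)
           dual_domain c\<^sub>0 l\<^sub>0"
proof -
  interpret online_stochastic_program M X C \<Delta> \<xi> \<gamma> h f g df dg N D\<^sub>1 D\<^sub>2 F G H by fact
  let ?fb = "window_average (fbar M X C \<xi> \<gamma> h f) t k"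
  let ?q = "dual_function \<Delta> ?fb (gbar M \<gamma> g) (hbar M h) b"
  have "0 < real k" using assms(2,5) by simp
  then have "1 \<le> k" by simp
  with assms(3) have opt: "optimal_solutions \<Delta> ?fb (gbar M \<gamma> g) (hbar M h) b \<noteq> {}"
    and max: "maximizers ?q dual_domain \<noteq> {}" "bounded (maximizers ?q dual_domain)"
    unfolding SELM_def by blast+
  have "\<Delta> \<noteq> {}"
    using opt by (auto simp: optimal_solutions_def is_arg_min_def feasible_def)
  then have conc: "concave_on UNIV ?q" by (rule concave_dual_function)
  \<comment> \<open>Concavity beyond the nonnegative orthant matters: it gives continuity up to the boundary.\<close>
  then have "continuous_on UNIV (\<lambda>v. - ?q v)"
    unfolding concave_on_def by (rule convex_on_continuous[OF open_UNIV])
  from continuous_on_minus[OF this] have "continuous_on UNIV ?q" by simp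
  then have "continuous_on dual_domain ?q"
    by (rule continuous_on_subset) (rule subset_UNIV)
  moreover have "concave_on dual_domain ?q"
    using conc convex_dual_domain unfolding concave_on_iff by blast
  ultimately have "\<exists>c>0. weak_error_bound ?q dual_domain c 1"
    using concave_weak_error_bound[OF closed_dual_domain _ _ max] by simp
  then show ?thesis by (meson zero_less_one)
qed

end
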